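(* Let $G$ and $G'$ be groups with generating subsets $S\subset G$ and $S'\subset G'$, and let $d_S,d_{S'}$ be the corresponding word metrics. If the metric space $(G,d_S)$ is a large-scale Lipschitz retract of $(G',d_{S'})$, then $\mathcal{R}_S(G)\preccurlyeq\mathcal{R}_{S'}(G')$.
   Context: For a group $G$ with a (not necessarily finite) generating subset $S$, let $F_S$ be the free group on $S$ with its word length, let $N$ be the kernel of the natural map $F_S\to G$, and for $n\ge 0$ let $N_n$ be the normal subgroup of $F_S$ generated (as a normal subgroup) by the elements of $N$ of length at most $n$ ($N_{-1}$ is trivial). The relation range $\mathcal{R}_S(G)$ is the set of integers $n\ge 0$ such that $N_n$ properly contains $N_{n-1}$. For $A,B\subset\mathbf{R}_+$, write $A\preccurlyeq B$ if there exists $c\ge 1$ such that for every $a\in A$ with $a\ge c$ there is an element of $B$ in the interval $[c^{-1}a,ca]$. A map $f:X\to Y$ between metric spaces is large-scale Lipschitz if there are constants $C,C'$ such that $d(f(x),f(x'))\le\max(Cd(x,x'),C')$ for all $x,x'\in X$. A metric space $X$ is a large-scale Lipschitz retract of a metric space $Y$ if there are large-scale Lipschitz maps $X\to Y\to X$ whose composite is at bounded distance from the identity map of $X$. *)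

theory Defs
  imports "HOL-Analysis.Abstract_Metric_Spaces" "HOL-Algebra.Generated_Groups"
begin

section \<open>Free groups\<close>

text \<open>The letter \<open>(s, True)\<close> stands for the generator \<open>s\<close> and \<open>(s, False)\<close> for its formal
  inverse. The free group on \<open>S\<close> is realised by the reduced words in these letters.\<close>

type_synonym 'a letter = "'a \<times> bool"

definition flip :: "'a letter \<Rightarrow> 'a letter" where
  "flip x = (fst x, \<not> snd x)"

fun reduced :: "'a letter list \<Rightarrow> bool" where
  "reduced (x # y # w) \<longleftrightarrow> y \<noteq> flip x \<and> reduced (y # w)"
| "reduced w \<longleftrightarrow> True"

fun cancel_cons :: "'a letter \<Rightarrow> 'a letter list \<Rightarrow> 'a letter list" where
  "cancel_cons x [] = [x]"
| "cancel_cons x (y # w) = (if y = flip x then w else x # y # w)"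

definition reduce :: "'a letter list \<Rightarrow> 'a letter list" where
  "reduce w = foldr cancel_cons w []"

definition free_group :: "'a set \<Rightarrow> 'a letter list monoid" where
  "free_group S = \<lparr>carrier = {w \<in> lists (S \<times> UNIV). reduced w},
     mult = (\<lambda>u v. reduce (u @ v)), one = []\<rparr>"

text \<open>The natural map from words (in particular from elements of the free group) to a group.\<close>

definition word_eval :: "('a, 'm) monoid_scheme \<Rightarrow> 'a letter list \<Rightarrow> 'a" where
  "word_eval G w =
     foldr (\<lambda>(s, e) g. (if e then s else inv\<^bsub>G\<^esub> s) \<otimes>\<^bsub>G\<^esub> g) w \<one>\<^bsub>G\<^esub>"

subsection \<open>The free group is a group and the natural map is a homomorphism\<close>

lemma flip_flip [simp]: "flip (flip x) = x"
  by (simp add: flip_def)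

lemma flip_in [simp]: "flip x \<in> S \<times> UNIV \<longleftrightarrow> x \<in> S \<times> UNIV"
  by (auto simp: flip_def mem_Times_iff)

lemma reduced_Cons: "reduced (x # w) \<Longrightarrow> reduced w"
  by (cases w) auto

lemma reduced_cancel_cons: "reduced w \<Longrightarrow> reduced (cancel_cons x w)"
  by (cases w) (auto dest: reduced_Cons)

lemma cancel_cons_flip: "reduced w \<Longrightarrow> cancel_cons (flip x) (cancel_cons x w) = w"
proof (cases w)
  case (Cons y v)
  assume "reduced w"
  then show ?thesis using Cons by (cases v) auto
qed simp

lemma cancel_cons_flip': "reduced w \<Longrightarrow> cancel_cons x (cancel_cons (flip x) w) = w"
  by (metis cancel_cons_flip flip_flip)

lemma reduced_foldr: "reduced w \<Longrightarrow> reduced (foldr cancel_cons u w)"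
  by (induction u) (auto intro: reduced_cancel_cons)

lemma reduced_reduce: "reduced (reduce w)"
  by (simp add: reduce_def reduced_foldr)

lemma reduce_append: "reduce (u @ v) = foldr cancel_cons u (reduce v)"
  by (simp add: reduce_def)

lemma foldr_cancel_cons:
  "reduced w \<Longrightarrow> foldr cancel_cons (cancel_cons x u) w = cancel_cons x (foldr cancel_cons u w)"
  by (cases u) (auto simp: cancel_cons_flip' reduced_foldr)

lemma foldr_reduce: "reduced w \<Longrightarrow> foldr cancel_cons (reduce u) w = foldr cancel_cons u w"
  by (induction u) (auto simp: reduce_def foldr_cancel_cons)

lemma reduce_reduced: "reduced w \<Longrightarrow> reduce w = w"
proof (induction w)
  case (Cons x w)
  then have "reduce (x # w) = cancel_cons x w"
    using reduced_Cons[OF Cons.prems] by (simp add: reduce_def)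
  then show ?case using Cons.prems by (cases w) auto
qed (simp add: reduce_def)

lemma reduce_reduce_append: "reduce (reduce u @ v) = reduce (u @ v)"
  by (simp add: reduce_append foldr_reduce reduced_reduce)

lemma reduce_append_reduce: "reduce (u @ reduce v) = reduce (u @ v)"
  by (simp add: reduce_append reduce_reduced reduced_reduce)

lemma cancel_cons_lists: "x \<in> A \<Longrightarrow> w \<in> lists A \<Longrightarrow> cancel_cons x w \<in> lists A"
  by (cases w) auto

lemma reduce_lists: "w \<in> lists A \<Longrightarrow> reduce w \<in> lists A"
proof (induction w)
  case (Cons x w)
  then show ?case
    using cancel_cons_lists[of x A "reduce w"] by (simp add: reduce_def)
qed (simp add: reduce_def)

lemma reduce_length: "length (reduce w) \<le> length w"
proof (induction w)
  case (Cons x w)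
  have "length (cancel_cons x (reduce w)) \<le> Suc (length (reduce w))"
    by (cases "reduce w") auto
  then show ?case using Cons by (simp add: reduce_def)
qed (simp add: reduce_def)

definition flip_word :: "'a letter list \<Rightarrow> 'a letter list" where
  "flip_word w = rev (map flip w)"

lemma flip_word_lists: "w \<in> lists (S \<times> UNIV) \<Longrightarrow> flip_word w \<in> lists (S \<times> UNIV)"
  by (induction w) (auto simp: flip_word_def flip_def)

lemma reduce_flip_word: "reduce (flip_word w @ w) = []"
proof (induction w)
  case (Cons x w)
  have "reduce (flip_word (x # w) @ x # w)
      = foldr cancel_cons (flip_word w) (cancel_cons (flip x) (cancel_cons x (reduce w)))"
    by (simp add: flip_word_def reduce_def)
  also have "\<dots> = reduce (flip_word w @ w)"
    by (simp add: cancel_cons_flip reduced_reduce reduce_append)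
  finally show ?case using Cons by simp
qed (simp add: flip_word_def reduce_def)

lemma group_free_group: "group (free_group S)"
proof (rule groupI)
  fix w assume w: "w \<in> carrier (free_group S)"
  have "reduce (flip_word w) \<in> carrier (free_group S)"
    using w by (auto simp: free_group_def reduced_reduce simp del: in_lists_conv_set
        intro!: reduce_lists flip_word_lists)
  moreover have "reduce (flip_word w) \<otimes>\<^bsub>free_group S\<^esub> w = \<one>\<^bsub>free_group S\<^esub>"
    by (simp add: free_group_def reduce_reduce_append reduce_flip_word)
  ultimately show "\<exists>y\<in>carrier (free_group S). y \<otimes>\<^bsub>free_group S\<^esub> w = \<one>\<^bsub>free_group S\<^esub>"
    by blast
next
  fix u v assume "u \<in> carrier (free_group S)" "v \<in> carrier (free_group S)"
  then show "u \<otimes>\<^bsub>free_group S\<^esub> v \<in> carrier (free_group S)"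
    by (auto simp: free_group_def reduced_reduce simp del: in_lists_conv_set intro!: reduce_lists)
qed (auto simp: free_group_def reduce_reduce_append reduce_append_reduce reduce_reduced)

context group
begin

lemma word_eval_Nil [simp]: "word_eval G [] = \<one>"
  by (simp add: word_eval_def)

lemma word_eval_Cons:
  "word_eval G (x # w) = (if snd x then fst x else inv (fst x)) \<otimes> word_eval G w"
  by (simp add: word_eval_def split_beta)

lemma word_eval_closed:
  assumes "S \<subseteq> carrier G" shows "w \<in> lists (S \<times> UNIV) \<Longrightarrow> word_eval G w \<in> carrier G"
  using assms by (induction w) (auto simp: word_eval_Cons)

lemma word_eval_append:
  assumes "S \<subseteq> carrier G" "v \<in> lists (S \<times> UNIV)"
  shows "u \<in> lists (S \<times> UNIV) \<Longrightarrow> word_eval G (u @ v) = word_eval G u \<otimes> word_eval G v"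
proof (induction u)
  case (Cons x u)
  then have "fst x \<in> carrier G" using assms(1) by auto
  with Cons show ?case
    using word_eval_closed[OF assms(1)] assms(2)
    by (auto simp: word_eval_Cons m_assoc simp del: in_lists_conv_set)
qed (use word_eval_closed[OF assms] in simp)

lemma word_eval_cancel_cons:
  assumes "S \<subseteq> carrier G" "x \<in> S \<times> UNIV" "w \<in> lists (S \<times> UNIV)"
  shows "word_eval G (cancel_cons x w) = word_eval G (x # w)"
proof (cases w)
  case (Cons y v)
  have x: "fst x \<in> carrier G" using assms by auto
  have v: "word_eval G v \<in> carrier G"
    using word_eval_closed[OF assms(1)] assms(3) Cons by simp
  show ?thesis using x v Cons
    by (auto simp: word_eval_Cons flip_def m_assoc[symmetric])
qed simp

lemma word_eval_reduce:
  assumes "S \<subseteq> carrier G"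
  shows "w \<in> lists (S \<times> UNIV) \<Longrightarrow> word_eval G (reduce w) = word_eval G w"
proof (induction w)
  case (Cons x w)
  then have "word_eval G (reduce (x # w)) = word_eval G (x # reduce w)"
    using word_eval_cancel_cons[OF assms, of x "reduce w"] reduce_lists[of w]
    by (auto simp: reduce_def simp del: in_lists_conv_set)
  then show ?case using Cons by (simp add: word_eval_Cons)
qed (simp add: reduce_def)

lemma word_eval_hom:
  assumes "S \<subseteq> carrier G" shows "word_eval G \<in> hom (free_group S) G"
  using word_eval_closed[OF assms] word_eval_append[OF assms] word_eval_reduce[OF assms]
  by (auto simp: hom_def free_group_def simp del: in_lists_conv_set)

lemma word_eval_flip_word:
  assumes "S \<subseteq> carrier G" "w \<in> lists (S \<times> UNIV)"
  shows "word_eval G (flip_word w) = inv (word_eval G w)"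
proof (rule inv_equality[symmetric])
  have "word_eval G (flip_word w) \<otimes> word_eval G w = word_eval G (flip_word w @ w)"
    using word_eval_append[OF assms flip_word_lists[OF assms(2)]] by simp
  also have "\<dots> = word_eval G (reduce (flip_word w @ w))"
    using word_eval_reduce[OF assms(1)] assms(2) flip_word_lists[OF assms(2)] by simp
  finally show "word_eval G (flip_word w) \<otimes> word_eval G w = \<one>"
    by (simp add: reduce_flip_word)
qed (use assms word_eval_closed flip_word_lists in blast)+

lemma word_eval_surj:
  assumes "S \<subseteq> carrier G"
  shows "g \<in> generate G S \<Longrightarrow> \<exists>w\<in>lists (S \<times> UNIV). word_eval G w = g"
proof (induction rule: generate.induct)
  case one
  show ?case by (rule bexI[of _ "[]"]) auto
next
  case (incl h)
  then show ?case using assms by (intro bexI[of _ "[(h, True)]"]) (auto simp: word_eval_Cons)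
next
  case (inv h)
  then show ?case using assms by (intro bexI[of _ "[(h, False)]"]) (auto simp: word_eval_Cons)
next
  case (eng h1 h2)
  then obtain u v where "u \<in> lists (S \<times> UNIV)" "v \<in> lists (S \<times> UNIV)"
    "word_eval G u = h1" "word_eval G v = h2" by blast
  then show ?case using word_eval_append[OF assms] by (intro bexI[of _ "u @ v"]) auto
qed

end

section \<open>The relation range\<close>

definition normal_closure :: "('a, 'm) monoid_scheme \<Rightarrow> 'a set \<Rightarrow> 'a set" where
  "normal_closure G A = \<Inter> {H. H \<lhd> G \<and> A \<subseteq> H}"

definition relators :: "('a, 'm) monoid_scheme \<Rightarrow> 'a set \<Rightarrow> 'a letter list set" where
  "relators G S = kernel (free_group S) G (word_eval G)"

text \<open>The word length of an element of the free group is the length of the reduced word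
  representing it. The index is an integer so that \<open>n = -1\<close> is covered.\<close>

definition relators_upto :: "('a, 'm) monoid_scheme \<Rightarrow> 'a set \<Rightarrow> int \<Rightarrow> 'a letter list set" where
  "relators_upto G S n =
     normal_closure (free_group S) {w \<in> relators G S. int (length w) \<le> n}"

definition relation_range :: "('a, 'm) monoid_scheme \<Rightarrow> 'a set \<Rightarrow> int set" where
  "relation_range G S = {n. 0 \<le> n \<and> relators_upto G S (n - 1) \<subset> relators_upto G S n}"

lemma (in group) normal_closure_normal:
  assumes "A \<subseteq> carrier G" shows "normal_closure G A \<lhd> G"
proof -
  let ?X = "{H. H \<lhd> G \<and> A \<subseteq> H}"
  have "carrier G \<in> ?X"
    using assms by (auto simp: normal_inv_iff subgroup_self)
  then have "subgroup (\<Inter> ?X) G"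
    by (intro subgroups_Inter) (auto simp: normal_inv_iff)
  then show ?thesis
    by (auto simp: normal_closure_def normal_inv_iff)
qed

lemma relators_upto_minus_one: "relators_upto G S (- 1) = {\<one>\<^bsub>free_group S\<^esub>}"
proof -
  interpret F: group "free_group S" by (rule group_free_group)
  have "{\<one>\<^bsub>free_group S\<^esub>} \<lhd> free_group S"
    by (rule F.one_is_normal)
  moreover have "\<one>\<^bsub>free_group S\<^esub> \<in> H" if "H \<lhd> free_group S" for H
    using that by (auto simp: F.normal_inv_iff subgroup.one_closed)
  ultimately show ?thesis
    by (auto simp: relators_upto_def normal_closure_def)
qed

section \<open>Word metrics\<close>

definition word_norm :: "('a, 'm) monoid_scheme \<Rightarrow> 'a set \<Rightarrow> 'a \<Rightarrow> nat" where
  "word_norm G S g = (LEAST n. \<exists>w \<in> lists (S \<times> UNIV). length w = n \<and> word_eval G w = g)"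

text \<open>The value \<open>0\<close> outside the carrier is needed only because \<^locale>\<open>Metric_space\<close> demands
  symmetry for all arguments.\<close>

definition word_dist :: "('a, 'm) monoid_scheme \<Rightarrow> 'a set \<Rightarrow> 'a \<Rightarrow> 'a \<Rightarrow> real" where
  "word_dist G S g h =
     (if g \<in> carrier G \<and> h \<in> carrier G then real (word_norm G S (inv\<^bsub>G\<^esub> g \<otimes>\<^bsub>G\<^esub> h)) else 0)"

lemma word_norm_le:
  "w \<in> lists (S \<times> UNIV) \<Longrightarrow> word_norm G S (word_eval G w) \<le> length w"
  unfolding word_norm_def by (rule Least_le) blast

lemma (in group) word_norm_attained:
  assumes "S \<subseteq> carrier G" "generate G S = carrier G" "g \<in> carrier G"
  obtains w where "w \<in> lists (S \<times> UNIV)" "length w = word_norm G S g" "word_eval G w = g"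
proof -
  have "\<exists>n. \<exists>w \<in> lists (S \<times> UNIV). length w = n \<and> word_eval G w = g"
    using word_eval_surj[OF assms(1)] assms(2,3) by blast
  from LeastI_ex[OF this] show ?thesis
    using that unfolding word_norm_def by blast
qed

lemma (in group) Metric_space_word_dist:
  assumes S: "S \<subseteq> carrier G" and gen: "generate G S = carrier G"
  shows "Metric_space (carrier G) (word_dist G S)"
proof
  fix x y z :: 'a
  show "0 \<le> word_dist G S x y"
    by (simp add: word_dist_def)
  have inv_le: "word_norm G S (inv g) \<le> word_norm G S g" if g: "g \<in> carrier G" for g
  proof -
    obtain w where w: "w \<in> lists (S \<times> UNIV)" "length w = word_norm G S g" "word_eval G w = g"
      using word_norm_attained[OF S gen g] .
    have "word_norm G S (word_eval G (flip_word w)) \<le> length (flip_word w)"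
      by (rule word_norm_le[OF flip_word_lists[OF w(1)]])
    then show ?thesis
      using w word_eval_flip_word[OF S w(1)] by (simp add: flip_word_def)
  qed
  show "word_dist G S x y = word_dist G S y x"
  proof (cases "x \<in> carrier G \<and> y \<in> carrier G")
    case True
    then have "inv (inv x \<otimes> y) = inv y \<otimes> x" "inv (inv y \<otimes> x) = inv x \<otimes> y"
      by (simp_all add: inv_mult_group)
    then show ?thesis
      using True inv_le[of "inv x \<otimes> y"] inv_le[of "inv y \<otimes> x"] by (simp add: word_dist_def)
  qed (auto simp: word_dist_def)
  show "word_dist G S x y = 0 \<longleftrightarrow> x = y" if xy: "x \<in> carrier G" "y \<in> carrier G"
  proof
    assume "word_dist G S x y = 0"
    then have 0: "word_norm G S (inv x \<otimes> y) = 0" using xy by (simp add: word_dist_def)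
    obtain w where "length w = word_norm G S (inv x \<otimes> y)" "word_eval G w = inv x \<otimes> y"
      using word_norm_attained[OF S gen, of "inv x \<otimes> y"] xy by auto
    with 0 have "inv x \<otimes> y = \<one>" by simp
    then show "x = y" using xy by (metis inv_closed inv_equality inv_inv)
  next
    assume "x = y"
    then show "word_dist G S x y = 0"
      using xy word_norm_le[of "[]" S G] by (simp add: word_dist_def)
  qed
  show "word_dist G S x z \<le> word_dist G S x y + word_dist G S y z"
    if xyz: "x \<in> carrier G" "y \<in> carrier G" "z \<in> carrier G"
  proof -
    obtain u where u: "u \<in> lists (S \<times> UNIV)" "length u = word_norm G S (inv x \<otimes> y)"
      "word_eval G u = inv x \<otimes> y"
      using word_norm_attained[OF S gen, of "inv x \<otimes> y"] xyz by auto
    obtain v where v: "v \<in> lists (S \<times> UNIV)" "length v = word_norm G S (inv y \<otimes> z)"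
      "word_eval G v = inv y \<otimes> z"
      using word_norm_attained[OF S gen, of "inv y \<otimes> z"] xyz by auto
    have "word_eval G (u @ v) = (inv x \<otimes> y) \<otimes> (inv y \<otimes> z)"
      using word_eval_append[OF S v(1) u(1)] u(3) v(3) by simp
    also have "\<dots> = inv x \<otimes> z"
      using xyz by (metis inv_closed m_assoc m_closed r_inv r_one)
    finally have "word_norm G S (inv x \<otimes> z) \<le> length (u @ v)"
      using word_norm_le[of "u @ v" S G] u(1) v(1) by simp
    then show ?thesis using xyz u(2) v(2) by (simp add: word_dist_def)
  qed
qed

section \<open>Large-scale notions\<close>

definition large_scale_Lipschitz ::
    "'a set \<Rightarrow> ('a \<Rightarrow> 'a \<Rightarrow> real) \<Rightarrow> 'b set \<Rightarrow> ('b \<Rightarrow> 'b \<Rightarrow> real) \<Rightarrow> ('a \<Rightarrow> 'b) \<Rightarrow> bool" where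
  "large_scale_Lipschitz X dX Y dY f \<longleftrightarrow>
     f \<in> X \<rightarrow> Y \<and> (\<exists>C C'. \<forall>x\<in>X. \<forall>x'\<in>X. dY (f x) (f x') \<le> max (C * dX x x') C')"

definition large_scale_Lipschitz_retract ::
    "'a set \<Rightarrow> ('a \<Rightarrow> 'a \<Rightarrow> real) \<Rightarrow> 'b set \<Rightarrow> ('b \<Rightarrow> 'b \<Rightarrow> real) \<Rightarrow> bool" where
  "large_scale_Lipschitz_retract X dX Y dY \<longleftrightarrow>
     (\<exists>f g. large_scale_Lipschitz X dX Y dY f \<and> large_scale_Lipschitz Y dY X dX g \<and>
       (\<exists>K. \<forall>x\<in>X. dX (g (f x)) x \<le> K))"

text \<open>Meant for subsets of the nonnegative reals.\<close>

definition range_dominated :: "real set \<Rightarrow> real set \<Rightarrow> bool"  (infix \<open>\<preceq>\<^sub>R\<close> 50) where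
  "A \<preceq>\<^sub>R B \<longleftrightarrow> (\<exists>c\<ge>1. \<forall>a\<in>A. a \<ge> c \<longrightarrow> (\<exists>b\<in>B. b \<in> {inverse c * a .. c * a}))"

end

theory Submission
  imports Defs
begin

text \<open>A relator of \<open>G\<close> of length at most \<open>a\<close> is a loop in the Cayley graph. Its image in the Cayley
  graph of \<open>G'\<close> is a loop of length \<open>O(a)\<close>, which, if \<open>G'\<close> has a gap in its relation range
  around \<open>a\<close>, is filled by loops of length much smaller than \<open>a\<close>. Mapping this filling back to \<open>G\<close>
  gives a filling by loops shorter than \<open>a\<close> of a loop that stays at bounded distance from the
  original one, so the two differ by loops of bounded length. Hence \<open>a\<close> does not belong to the
  relation range of \<open>G\<close>.\<close>

section \<open>Words modulo short relators\<close>

lemma carrier_free_group: "w \<in> carrier (free_group S) \<longleftrightarrow> w \<in> lists (S \<times> UNIV) \<and> reduced w"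
  by (simp add: free_group_def)

lemma reduce_in_carrier: "w \<in> lists (S \<times> UNIV) \<Longrightarrow> reduce w \<in> carrier (free_group S)"
  by (simp add: carrier_free_group reduced_reduce reduce_lists del: in_lists_conv_set)

lemma length_flip_word [simp]: "length (flip_word w) = length w"
  by (simp add: flip_word_def)

section \<open>The increasing filtration by normal closures of short relators\<close>

lemma normal_closure_mono: "A \<subseteq> B \<Longrightarrow> normal_closure G A \<subseteq> normal_closure G B"
  by (auto simp: normal_closure_def)

lemma normal_closure_superset: "A \<subseteq> normal_closure G A"
  by (auto simp: normal_closure_def)

lemma normal_closure_least: "H \<lhd> G \<Longrightarrow> A \<subseteq> H \<Longrightarrow> normal_closure G A \<subseteq> H"
  by (auto simp: normal_closure_def)

lemma relators_upto_mono: "m \<le> n \<Longrightarrow> relators_upto G S m \<subseteq> relators_upto G S n"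
  unfolding relators_upto_def by (intro normal_closure_mono) auto

lemma relators_upto_normal: "relators_upto G S n \<lhd> free_group S"
  unfolding relators_upto_def
  by (rule group.normal_closure_normal[OF group_free_group]) (auto simp: relators_def kernel_def)

text \<open>The filtration is increasing, and an index outside the relation range is one at which it
  does not grow, so it is constant along a gap. Since \<open>0 \<le> m\<close>, every index passed
  is nonnegative, as membership in \<open>relation_range\<close> requires.\<close>

lemma relators_upto_gap:
  assumes "m \<le> n" "0 \<le> m" "\<And>i. m < i \<Longrightarrow> i \<le> n \<Longrightarrow> i \<notin> relation_range G S"
  shows "relators_upto G S n = relators_upto G S m"
  using assms
proof (induction n rule: int_ge_induct)
  case (step i)
  have "relators_upto G S i \<subseteq> relators_upto G S (i + 1)"
    by (rule relators_upto_mono) simp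
  moreover have "i + 1 \<notin> relation_range G S" using step by simp
  ultimately have "relators_upto G S (i + 1) = relators_upto G S i"
    using step by (auto simp: relation_range_def)
  then show ?case using step by simp
qed simp

section \<open>The quotient of the free group by short relators\<close>

text \<open>Reducing first gives arbitrary words a class, so paths can be concatenated without
  tracking cancellations.\<close>

definition word_class ::
    "('a, 'm) monoid_scheme \<Rightarrow> 'a set \<Rightarrow> int \<Rightarrow> 'a letter list \<Rightarrow> 'a letter list set" where
  "word_class G S n w = relators_upto G S n #>\<^bsub>free_group S\<^esub> reduce w"

text \<open>This is the group presented by the generators \<open>S\<close> and the relators of
  \<open>G\<close> of length at most \<open>n\<close>.\<close>

definition word_class_group ::
    "('a, 'm) monoid_scheme \<Rightarrow> 'a set \<Rightarrow> int \<Rightarrow> 'a letter list set monoid" where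
  "word_class_group G S n = free_group S Mod relators_upto G S n"

lemma group_word_class_group: "group (word_class_group G S n)"
  unfolding word_class_group_def by (rule normal.factorgroup_is_group[OF relators_upto_normal])

lemma word_class_closed:
  "w \<in> lists (S \<times> UNIV) \<Longrightarrow> word_class G S n w \<in> carrier (word_class_group G S n)"
  using reduce_in_carrier[of w S]
  by (auto simp: word_class_def word_class_group_def FactGroup_def RCOSETS_def
      simp del: in_lists_conv_set)

lemma word_class_append:
  assumes "u \<in> lists (S \<times> UNIV)" "v \<in> lists (S \<times> UNIV)"
  shows "word_class G S n (u @ v)
    = word_class G S n u \<otimes>\<^bsub>word_class_group G S n\<^esub> word_class G S n v"
proof -
  have "reduce u \<otimes>\<^bsub>free_group S\<^esub> reduce v = reduce (u @ v)"
    by (simp add: free_group_def reduce_reduce_append reduce_append_reduce)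
  then show ?thesis
    using normal.rcos_sum[OF relators_upto_normal, of "reduce u" S "reduce v" G n]
      assms[THEN reduce_in_carrier]
    by (simp add: word_class_def word_class_group_def)
qed

lemma word_class_eq_one_iff:
  assumes "w \<in> lists (S \<times> UNIV)"
  shows "word_class G S n w = \<one>\<^bsub>word_class_group G S n\<^esub> \<longleftrightarrow> reduce w \<in> relators_upto G S n"
proof -
  interpret F: group "free_group S" by (rule group_free_group)
  interpret N: normal "relators_upto G S n" "free_group S" by (rule relators_upto_normal)
  show ?thesis
    using F.coset_join1[OF _ _ N.subgroup_axioms] F.coset_join2[OF _ N.subgroup_axioms]
      reduce_in_carrier[OF assms] N.subset
    by (auto simp: word_class_def word_class_group_def)
qed

lemma word_class_Nil: "word_class G S n [] = \<one>\<^bsub>word_class_group G S n\<^esub>"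
proof -
  interpret N: normal "relators_upto G S n" "free_group S" by (rule relators_upto_normal)
  have "\<one>\<^bsub>free_group S\<^esub> = []" by (simp add: free_group_def)
  then have "[] \<in> relators_upto G S n" using subgroup.one_closed[OF N.subgroup_axioms] by simp
  then show ?thesis by (simp add: word_class_eq_one_iff reduce_def)
qed

lemma (in group) reduce_in_relators:
  assumes "S \<subseteq> carrier G" "w \<in> lists (S \<times> UNIV)" "word_eval G w = \<one>"
  shows "reduce w \<in> relators G S"
  using assms reduce_in_carrier[OF assms(2)]
  by (simp add: relators_def kernel_def word_eval_reduce del: in_lists_conv_set)

text \<open>Free reduction never lengthens a word, so the length bound may be checked before
  reducing.\<close>

lemma (in group) reduce_in_relators_upto:
  assumes "S \<subseteq> carrier G" "w \<in> lists (S \<times> UNIV)" "word_eval G w = \<one>" "int (length w) \<le> n"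
  shows "reduce w \<in> relators_upto G S n"
proof -
  have "reduce w \<in> {w \<in> relators G S. int (length w) \<le> n}"
    using reduce_in_relators[OF assms(1-3)] assms(4) reduce_length[of w] by simp
  then show ?thesis
    unfolding relators_upto_def by (rule subsetD[OF normal_closure_superset])
qed

text \<open>Following \<open>u\<close> and then \<open>v\<close> backwards gives a loop of length at
  most \<open>n\<close>, which is trivial in the quotient. All short loops below are filled through
  this criterion.\<close>

lemma (in group) word_class_eqI:
  assumes S: "S \<subseteq> carrier G" and u: "u \<in> lists (S \<times> UNIV)" and v: "v \<in> lists (S \<times> UNIV)"
    and ev: "word_eval G u = word_eval G v" and len: "int (length u + length v) \<le> n"
  shows "word_class G S n u = word_class G S n v"
proof -
  interpret Q: group "word_class_group G S n" by (rule group_word_class_group)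
  let ?c = "word_class G S n" and ?v = "flip_word v"
  have fv: "?v \<in> lists (S \<times> UNIV)" using v by (rule flip_word_lists)
  have "word_eval G (?v @ u) = \<one>"
    using word_eval_append[OF S u fv] word_eval_flip_word[OF S v] word_eval_closed[OF S v] ev
    by simp
  then have "?c (?v @ u) = \<one>\<^bsub>word_class_group G S n\<^esub>"
    using reduce_in_relators_upto[OF S, of "?v @ u" n] u fv len
    by (simp add: word_class_eq_one_iff del: in_lists_conv_set)
  \<comment> \<open>The length of this loop may exceed \<open>n\<close>; it is trivial because it
    freely reduces to the empty word.\<close>
  moreover have "?c (?v @ v) = \<one>\<^bsub>word_class_group G S n\<^esub>"
  proof -
    have "reduce [] \<in> relators_upto G S n"
      using word_class_Nil[of G S n] word_class_eq_one_iff[of "[]" S G n] by simp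
    then have "reduce (?v @ v) \<in> relators_upto G S n"
      by (simp add: reduce_flip_word reduce_reduced)
    then show ?thesis using v fv by (simp add: word_class_eq_one_iff del: in_lists_conv_set)
  qed
  ultimately have "?c ?v \<otimes>\<^bsub>word_class_group G S n\<^esub> ?c u
      = ?c ?v \<otimes>\<^bsub>word_class_group G S n\<^esub> ?c v"
    using word_class_append[OF fv u] word_class_append[OF fv v] by metis
  then show ?thesis
    using Q.Units_l_cancel[of "?c ?v" "?c u" "?c v"]
      word_class_closed[OF u, of G n] word_class_closed[OF v, of G n]
      word_class_closed[OF fv, of G n]
    by (simp add: Q.Units_eq)
qed

section \<open>Images of paths\<close>

lemma (in group) inv_mult_telescope:
  assumes "a \<in> carrier G" "b \<in> carrier G" "c \<in> carrier G"
  shows "(inv a \<otimes> b) \<otimes> (inv b \<otimes> c) = inv a \<otimes> c"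
proof -
  have "(inv a \<otimes> b) \<otimes> (inv b \<otimes> c) = inv a \<otimes> ((b \<otimes> inv b) \<otimes> c)"
    using assms by (metis inv_closed m_assoc m_closed)
  then show ?thesis using assms by simp
qed

text \<open>A word read from the vertex \<open>y\<close> is a path in the Cayley graph; each of its edges, from \<open>y\<close> to
  \<open>z\<close> say, is replaced by the word \<open>e y z\<close>.\<close>

primrec path_map ::
    "('a, 'm) monoid_scheme \<Rightarrow> ('a \<Rightarrow> 'a \<Rightarrow> 'b letter list) \<Rightarrow> 'a \<Rightarrow> 'a letter list
      \<Rightarrow> 'b letter list" where
  "path_map G e y [] = []"
| "path_map G e y (x # w) =
     e y (y \<otimes>\<^bsub>G\<^esub> word_eval G [x]) @ path_map G e (y \<otimes>\<^bsub>G\<^esub> word_eval G [x]) w"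

text \<open>A map \<open>f\<close> of vertices is extended to edges by words \<open>e y z\<close>
  leading from \<open>f y\<close> to \<open>f z\<close>, of length at most \<open>C\<close> when
  \<open>y\<close> and \<open>z\<close> are adjacent. The word \<open>e z y\<close> need not be the
  formal inverse of \<open>e y z\<close>, so backtracking is respected only modulo short
  relators.\<close>

locale edge_map = G: group G + H: group H
  for G :: "('a, 'm) monoid_scheme" and H :: "('b, 'n) monoid_scheme" +
  fixes S :: "'a set" and T :: "'b set" and f :: "'a \<Rightarrow> 'b" and e and C :: nat
  assumes S: "S \<subseteq> carrier G" and T: "T \<subseteq> carrier H"
    and f: "y \<in> carrier G \<Longrightarrow> f y \<in> carrier H"
    and edge_lists: "y \<in> carrier G \<Longrightarrow> z \<in> carrier G \<Longrightarrow> e y z \<in> lists (T \<times> UNIV)"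
    and edge_eval: "y \<in> carrier G \<Longrightarrow> z \<in> carrier G \<Longrightarrow>
      word_eval H (e y z) = inv\<^bsub>H\<^esub> f y \<otimes>\<^bsub>H\<^esub> f z"
    and edge_length: "y \<in> carrier G \<Longrightarrow> x \<in> S \<times> UNIV \<Longrightarrow>
      length (e y (y \<otimes>\<^bsub>G\<^esub> word_eval G [x])) \<le> C"
begin

lemma letter_closed: "x \<in> S \<times> UNIV \<Longrightarrow> word_eval G [x] \<in> carrier G"
  using G.word_eval_closed[OF S, of "[x]"] by simp

lemma eval_Cons:
  assumes "x \<in> S \<times> UNIV" "w \<in> lists (S \<times> UNIV)" "y \<in> carrier G"
  shows "y \<otimes>\<^bsub>G\<^esub> word_eval G (x # w) = (y \<otimes>\<^bsub>G\<^esub> word_eval G [x]) \<otimes>\<^bsub>G\<^esub> word_eval G w"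
  using G.word_eval_append[OF S assms(2), of "[x]"] assms letter_closed[of x]
    G.word_eval_closed[OF S assms(2)]
  by (simp add: G.m_assoc del: in_lists_conv_set)

lemma eval_flip:
  assumes "x \<in> S \<times> UNIV" "y \<in> carrier G"
  shows "y \<otimes>\<^bsub>G\<^esub> word_eval G [x] \<otimes>\<^bsub>G\<^esub> word_eval G [flip x] = y"
proof -
  have "word_eval G [flip x] = inv\<^bsub>G\<^esub> word_eval G [x]"
    using G.word_eval_flip_word[OF S, of "[x]"] assms by (simp add: flip_word_def)
  then show ?thesis using assms letter_closed[of x] by (simp add: G.m_assoc)
qed

lemma path_map_lists:
  "w \<in> lists (S \<times> UNIV) \<Longrightarrow> y \<in> carrier G \<Longrightarrow> path_map G e y w \<in> lists (T \<times> UNIV)"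
proof (induction w arbitrary: y)
  case (Cons x w)
  then have "y \<otimes>\<^bsub>G\<^esub> word_eval G [x] \<in> carrier G" using letter_closed by simp
  then show ?case
    using Cons.IH[of "y \<otimes>\<^bsub>G\<^esub> word_eval G [x]"] Cons.prems edge_lists
    by (simp del: in_lists_conv_set)
qed simp

lemma path_map_length:
  "w \<in> lists (S \<times> UNIV) \<Longrightarrow> y \<in> carrier G \<Longrightarrow> length (path_map G e y w) \<le> C * length w"
proof (induction w arbitrary: y)
  case (Cons x w)
  then have "y \<otimes>\<^bsub>G\<^esub> word_eval G [x] \<in> carrier G" using letter_closed by simp
  then show ?case
    using Cons.IH[of "y \<otimes>\<^bsub>G\<^esub> word_eval G [x]"] Cons.prems edge_length[of y x]
    by (simp del: in_lists_conv_set)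
qed simp

text \<open>The displacements of consecutive edges telescope. In particular, loops are sent to
  loops.\<close>

lemma path_map_eval:
  "w \<in> lists (S \<times> UNIV) \<Longrightarrow> y \<in> carrier G \<Longrightarrow>
    word_eval H (path_map G e y w) = inv\<^bsub>H\<^esub> f y \<otimes>\<^bsub>H\<^esub> f (y \<otimes>\<^bsub>G\<^esub> word_eval G w)"
proof (induction w arbitrary: y)
  case Nil
  then show ?case using f by simp
next
  case (Cons x w)
  define z where "z = y \<otimes>\<^bsub>G\<^esub> word_eval G [x]"
  define t where "t = z \<otimes>\<^bsub>G\<^esub> word_eval G w"
  have z: "z \<in> carrier G" using Cons.prems letter_closed by (simp add: z_def)
  have w: "w \<in> lists (S \<times> UNIV)" using Cons.prems by simp
  have t: "t \<in> carrier G" using z w G.word_eval_closed[OF S] by (simp add: t_def)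
  have "word_eval H (path_map G e y (x # w))
      = (inv\<^bsub>H\<^esub> f y \<otimes>\<^bsub>H\<^esub> f z) \<otimes>\<^bsub>H\<^esub> (inv\<^bsub>H\<^esub> f z \<otimes>\<^bsub>H\<^esub> f t)"
    using H.word_eval_append[OF T path_map_lists[OF w z] edge_lists[of y z]]
      Cons.IH[OF w z] edge_eval[of y z] Cons.prems z
    by (simp add: z_def t_def)
  also have "\<dots> = inv\<^bsub>H\<^esub> f y \<otimes>\<^bsub>H\<^esub> f t"
    by (rule H.inv_mult_telescope[OF f[OF Cons.prems(2)] f[OF z] f[OF t]])
  finally show ?case
    using eval_Cons[of x w y] Cons.prems by (simp add: t_def z_def)
qed

lemma path_map_append:
  "u \<in> lists (S \<times> UNIV) \<Longrightarrow> v \<in> lists (S \<times> UNIV) \<Longrightarrow> y \<in> carrier G \<Longrightarrow>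
    path_map G e y (u @ v) = path_map G e y u @ path_map G e (y \<otimes>\<^bsub>G\<^esub> word_eval G u) v"
proof (induction u arbitrary: y)
  case (Cons x u)
  then have "y \<otimes>\<^bsub>G\<^esub> word_eval G [x] \<in> carrier G" using letter_closed by simp
  then show ?case
    using Cons eval_Cons[of x u y] by (simp del: in_lists_conv_set)
qed simp

section \<open>Images of paths modulo short relators\<close>

text \<open>A cancelled pair runs along an edge and back. Its image \<open>e y z @ e z y\<close> is
  a loop of length at most \<open>2 * C\<close>, hence trivial modulo relators of length at most
  \<open>k\<close>.\<close>

lemma path_map_class_cancel_cons:
  assumes k: "int (2 * C) \<le> k" and x: "x \<in> S \<times> UNIV" and w: "w \<in> lists (S \<times> UNIV)"
    and y: "y \<in> carrier G"
  shows "word_class H T k (path_map G e y (cancel_cons x w))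
    = word_class H T k (path_map G e y (x # w))"
proof (cases "\<exists>v. w = flip x # v")
  case True
  then obtain v where v: "w = flip x # v" by blast
  interpret Q: group "word_class_group H T k" by (rule group_word_class_group)
  define z where "z = y \<otimes>\<^bsub>G\<^esub> word_eval G [x]"
  have z: "z \<in> carrier G" using y x letter_closed by (simp add: z_def)
  have ret: "z \<otimes>\<^bsub>G\<^esub> word_eval G [flip x] = y" unfolding z_def by (rule eval_flip[OF x y])
  have vl: "v \<in> lists (S \<times> UNIV)" using w v by simp
  have l: "e y z \<in> lists (T \<times> UNIV)" "e z y \<in> lists (T \<times> UNIV)"
    using edge_lists y z by auto
  have "length (e y z) \<le> C" using edge_length[OF y x] by (simp add: z_def)
  \<comment> \<open>The way back is itself an edge, read from \<open>z\<close> with the letter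
    \<open>flip x\<close>.\<close>
  moreover have "length (e z y) \<le> C" using edge_length[OF z, of "flip x"] x ret by simp
  moreover have "word_eval H (e y z @ e z y) = \<one>\<^bsub>H\<^esub>"
    using H.word_eval_append[OF T l(2,1)] edge_eval[OF y z] edge_eval[OF z y] f[OF y] f[OF z]
      H.inv_mult_telescope[of "f y" "f z" "f y"]
    by simp
  ultimately have loop: "word_class H T k (e y z @ e z y) = \<one>\<^bsub>word_class_group H T k\<^esub>"
    using H.word_class_eqI[OF T, of "e y z @ e z y" "[]" k] l k
    by (simp add: word_class_Nil del: in_lists_conv_set)
  have "path_map G e y (x # w) = (e y z @ e z y) @ path_map G e y v"
    using ret by (simp add: v z_def)
  then have "word_class H T k (path_map G e y (x # w)) = word_class H T k (path_map G e y v)"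
    using word_class_append[of "e y z @ e z y" T "path_map G e y v" H k] l loop
      path_map_lists[OF vl y] word_class_closed[OF path_map_lists[OF vl y], of H k]
    by (simp del: in_lists_conv_set)
  then show ?thesis by (simp add: v)
next
  case False
  then have "cancel_cons x w = x # w" by (cases w) auto
  then show ?thesis by simp
qed

text \<open>Reduction iterates \<open>cancel_cons\<close>, one letter at a time. Thus the class of
  the image depends only on the element of the free group that the word represents.\<close>

lemma path_map_class_reduce:
  assumes k: "int (2 * C) \<le> k"
  shows "w \<in> lists (S \<times> UNIV) \<Longrightarrow> y \<in> carrier G \<Longrightarrow>
    word_class H T k (path_map G e y (reduce w)) = word_class H T k (path_map G e y w)"
proof (induction w arbitrary: y)
  case (Cons x w)
  define z where "z = y \<otimes>\<^bsub>G\<^esub> word_eval G [x]"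
  have z: "z \<in> carrier G" using Cons.prems letter_closed by (simp add: z_def)
  have w: "x \<in> S \<times> UNIV" "w \<in> lists (S \<times> UNIV)" using Cons.prems by auto
  have rw: "reduce w \<in> lists (S \<times> UNIV)" by (rule reduce_lists[OF w(2)])
  have l: "e y z \<in> lists (T \<times> UNIV)" using edge_lists Cons.prems z by simp
  have "word_class H T k (path_map G e y (reduce (x # w)))
      = word_class H T k (path_map G e y (x # reduce w))"
    using path_map_class_cancel_cons[OF k w(1) rw Cons.prems(2)] by (simp add: reduce_def)
  also have "\<dots> = word_class H T k (path_map G e y (x # w))"
    using word_class_append[OF l path_map_lists[OF rw z], of H k]
      word_class_append[OF l path_map_lists[OF w(2) z], of H k] Cons.IH[OF w(2) z]
    by (simp add: z_def)
  finally show ?case .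
qed (simp add: reduce_def)

text \<open>All base points occur because conjugating a loop moves its base point; requiring
  relators makes each path return to its start.\<close>

definition killed_loops :: "int \<Rightarrow> 'a letter list set" where
  "killed_loops k = {w \<in> relators G S.
     \<forall>y\<in>carrier G. word_class H T k (path_map G e y w) = \<one>\<^bsub>word_class_group H T k\<^esub>}"

text \<open>For varying \<open>y\<close> the maps \<open>?c y\<close> satisfy a crossed homomorphism
  rule, the second factor being read from the endpoint of the first. On relators the base point
  returns, so the rule becomes multiplicative.\<close>

lemma killed_loops_normal:
  assumes k: "int (2 * C) \<le> k"
  shows "killed_loops k \<lhd> free_group S"
proof -
  interpret F: group "free_group S" by (rule group_free_group)
  interpret Q: group "word_class_group H T k" by (rule group_word_class_group)
  interpret ev: group_hom "free_group S" G "word_eval G"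
    by unfold_locales (rule G.word_eval_hom[OF S])
  let ?c = "\<lambda>y w. word_class H T k (path_map G e y w)" and ?F = "free_group S"
  have lists: "w \<in> lists (S \<times> UNIV)" if "w \<in> carrier ?F" for w
    using that by (simp add: carrier_free_group)
  have closed: "?c y w \<in> carrier (word_class_group H T k)"
    if "w \<in> carrier ?F" "y \<in> carrier G" for y w
    by (rule word_class_closed[OF path_map_lists[OF lists[OF that(1)] that(2)]])
  have mult: "?c y (u \<otimes>\<^bsub>?F\<^esub> v)
      = ?c y u \<otimes>\<^bsub>word_class_group H T k\<^esub> ?c (y \<otimes>\<^bsub>G\<^esub> word_eval G u) v"
    if "u \<in> carrier ?F" "v \<in> carrier ?F" "y \<in> carrier G" for u v y
  proof -
    have u: "u \<in> lists (S \<times> UNIV)" and v: "v \<in> lists (S \<times> UNIV)"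
      using that lists by auto
    have yu: "y \<otimes>\<^bsub>G\<^esub> word_eval G u \<in> carrier G" using that by simp
    moreover have "?c y (u \<otimes>\<^bsub>?F\<^esub> v) = ?c y (u @ v)"
      using path_map_class_reduce[OF k, of "u @ v" y] u v that
      by (simp add: free_group_def del: in_lists_conv_set)
    ultimately show ?thesis
      using path_map_append[OF u v that(3)]
        word_class_append[OF path_map_lists[OF u that(3)] path_map_lists[OF v yu], of H k]
      by simp
  qed
  have one: "?c y \<one>\<^bsub>?F\<^esub> = \<one>\<^bsub>word_class_group H T k\<^esub>" for y
    by (simp add: free_group_def word_class_Nil)
  have killed: "w \<in> killed_loops k \<longleftrightarrow> w \<in> carrier ?F \<and> word_eval G w = \<one>\<^bsub>G\<^esub> \<and>
      (\<forall>y\<in>carrier G. ?c y w = \<one>\<^bsub>word_class_group H T k\<^esub>)" for w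
    by (auto simp: killed_loops_def relators_def kernel_def)
  have sub: "subgroup (killed_loops k) ?F"
  proof (rule subgroup.intro)
    show "killed_loops k \<subseteq> carrier ?F" using killed by blast
    show "\<one>\<^bsub>?F\<^esub> \<in> killed_loops k" unfolding killed using one by simp
    show "u \<otimes>\<^bsub>?F\<^esub> v \<in> killed_loops k" if "u \<in> killed_loops k" "v \<in> killed_loops k" for u v
      using that unfolding killed by (simp add: mult)
    show "inv\<^bsub>?F\<^esub> w \<in> killed_loops k" if w: "w \<in> killed_loops k" for w
    proof -
      have wF: "w \<in> carrier ?F" and ev: "word_eval G w = \<one>\<^bsub>G\<^esub>" using w killed by blast+
      have "?c y (inv\<^bsub>?F\<^esub> w) = \<one>\<^bsub>word_class_group H T k\<^esub>" if y: "y \<in> carrier G" for y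
      proof -
        \<comment> \<open>As \<open>w\<close> closes up, its inverse is again read from
          \<open>y\<close>, and the two classes multiply to the class of the empty word.\<close>
        have "?c y w = \<one>\<^bsub>word_class_group H T k\<^esub>" using w y killed by blast
        then show ?thesis
          using mult[of w "inv\<^bsub>?F\<^esub> w" y] wF y ev one[of y] closed[of "inv\<^bsub>?F\<^esub> w" y] by simp
      qed
      then show ?thesis unfolding killed using wF ev by simp
    qed
  qed
  have "u \<otimes>\<^bsub>?F\<^esub> w \<otimes>\<^bsub>?F\<^esub> inv\<^bsub>?F\<^esub> u \<in> killed_loops k"
    if u: "u \<in> carrier ?F" and w: "w \<in> killed_loops k" for u w
  proof -
    have wF: "w \<in> carrier ?F" using w by (simp add: killed)
    have "?c y (u \<otimes>\<^bsub>?F\<^esub> w \<otimes>\<^bsub>?F\<^esub> inv\<^bsub>?F\<^esub> u) = ?c y (u \<otimes>\<^bsub>?F\<^esub> inv\<^bsub>?F\<^esub> u)"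
      if "y \<in> carrier G" for y
    proof -
      have "?c y (u \<otimes>\<^bsub>?F\<^esub> w \<otimes>\<^bsub>?F\<^esub> inv\<^bsub>?F\<^esub> u)
          = ?c y u \<otimes>\<^bsub>word_class_group H T k\<^esub> ?c (y \<otimes>\<^bsub>G\<^esub> word_eval G u) (inv\<^bsub>?F\<^esub> u)"
        using that u w wF closed by (simp add: killed mult)
      then show ?thesis using mult[OF u F.inv_closed[OF u] that] by simp
    qed
    then show ?thesis using u w wF one by (simp add: killed)
  qed
  with sub show ?thesis by (simp add: F.normal_inv_iff)
qed

text \<open>By normality it suffices to treat relators of length at most \<open>m\<close>; their
  images are loops of length at most \<open>C * m\<close>, hence at most \<open>k\<close>.\<close>

lemma relators_upto_killed:
  assumes k: "int (2 * C) \<le> k" and m: "int C * m \<le> k"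
  shows "relators_upto G S m \<subseteq> killed_loops k"
  unfolding relators_upto_def
proof (rule normal_closure_least[OF killed_loops_normal[OF k]], rule subsetI)
  fix w assume w: "w \<in> {w \<in> relators G S. int (length w) \<le> m}"
  then have wl: "w \<in> lists (S \<times> UNIV)" and ev: "word_eval G w = \<one>\<^bsub>G\<^esub>"
    by (simp_all add: relators_def kernel_def carrier_free_group)
  have "word_class H T k (path_map G e y w) = \<one>\<^bsub>word_class_group H T k\<^esub>"
    if y: "y \<in> carrier G" for y
  proof -
    have "int (length (path_map G e y w)) \<le> int C * int (length w)"
      using path_map_length[OF wl y] by (metis of_nat_le_iff of_nat_mult)
    also have "\<dots> \<le> int C * m" using w by (intro mult_left_mono) auto
    finally have "int (length (path_map G e y w)) \<le> k" using m by simp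
    moreover have "word_eval H (path_map G e y w) = \<one>\<^bsub>H\<^esub>"
      using path_map_eval[OF wl y] ev y f by simp
    ultimately show ?thesis
      using H.word_class_eqI[OF T path_map_lists[OF wl y], of "[]" k] by (simp add: word_class_Nil)
  qed
  then show "w \<in> killed_loops k" using w by (simp add: killed_loops_def)
qed

end

section \<open>From large-scale Lipschitz maps to edge maps\<close>

text \<open>Take for \<open>e y z\<close> a shortest word from \<open>f y\<close> to
  \<open>f z\<close>. Adjacent vertices are at distance at most 1, so the Lipschitz inequality
  bounds its length uniformly.\<close>

lemma edge_map_of_Lipschitz:
  assumes G: "group G" and H: "group H" and S: "S \<subseteq> carrier G" and T: "T \<subseteq> carrier H"
    and gen: "generate H T = carrier H"
    and f: "large_scale_Lipschitz (carrier G) (word_dist G S) (carrier H) (word_dist H T) f"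
  obtains e C where "edge_map G H S T f e C"
proof -
  interpret G: group G by (rule G)
  interpret H: group H by (rule H)
  from f obtain L L' where fc: "\<And>y. y \<in> carrier G \<Longrightarrow> f y \<in> carrier H"
    and L: "\<And>y z. y \<in> carrier G \<Longrightarrow> z \<in> carrier G \<Longrightarrow>
      word_dist H T (f y) (f z) \<le> max (L * word_dist G S y z) L'"
    unfolding large_scale_Lipschitz_def by blast
  have "\<exists>w. w \<in> lists (T \<times> UNIV) \<and> length w = word_norm H T (inv\<^bsub>H\<^esub> f y \<otimes>\<^bsub>H\<^esub> f z) \<and>
      word_eval H w = inv\<^bsub>H\<^esub> f y \<otimes>\<^bsub>H\<^esub> f z" if "y \<in> carrier G" "z \<in> carrier G" for y z
    using H.word_norm_attained[OF T gen, of "inv\<^bsub>H\<^esub> f y \<otimes>\<^bsub>H\<^esub> f z"] fc that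
    by (metis H.inv_closed H.m_closed)
  then obtain e where e: "\<And>y z. y \<in> carrier G \<Longrightarrow> z \<in> carrier G \<Longrightarrow>
      e y z \<in> lists (T \<times> UNIV) \<and> length (e y z) = word_norm H T (inv\<^bsub>H\<^esub> f y \<otimes>\<^bsub>H\<^esub> f z) \<and>
      word_eval H (e y z) = inv\<^bsub>H\<^esub> f y \<otimes>\<^bsub>H\<^esub> f z"
    by metis
  \<comment> \<open>The absolute value covers a negative \<open>L\<close> and adjacent vertices that
    coincide.\<close>
  define C where "C = nat \<lceil>max \<bar>L\<bar> L'\<rceil>"
  have "length (e y (y \<otimes>\<^bsub>G\<^esub> word_eval G [x])) \<le> C"
    if y: "y \<in> carrier G" and x: "x \<in> S \<times> UNIV" for x y
  proof -
    define s where "s = word_eval G [x]"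
    define z where "z = y \<otimes>\<^bsub>G\<^esub> s"
    have s: "s \<in> carrier G" using G.word_eval_closed[OF S, of "[x]"] x by (simp add: s_def)
    have z: "z \<in> carrier G" using y s by (simp add: z_def)
    have "inv\<^bsub>G\<^esub> y \<otimes>\<^bsub>G\<^esub> z = s" using y s by (simp add: z_def G.m_assoc[symmetric])
    moreover have "word_norm G S s \<le> 1" using word_norm_le[of "[x]" S G] x by (simp add: s_def)
    ultimately have d: "0 \<le> word_dist G S y z" "word_dist G S y z \<le> 1"
      using y z by (auto simp: word_dist_def)
    have "L * word_dist G S y z \<le> \<bar>L\<bar> * 1"
      using d by (intro mult_mono) auto
    then have "word_dist H T (f y) (f z) \<le> max \<bar>L\<bar> L'"
      using L[OF y z] by linarith
    moreover have "word_dist H T (f y) (f z) = real (length (e y z))"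
      using e[OF y z] fc y z by (simp add: word_dist_def)
    ultimately show ?thesis by (simp add: C_def z_def s_def) linarith
  qed
  then have "edge_map G H S T f e C"
    using e fc S T by unfold_locales auto
  then show thesis by (rule that)
qed

section \<open>Gaps in the relation range\<close>

text \<open>The bound \<open>k\<close> accommodates three kinds of loops in \<open>G\<close>:
  backtracks (\<open>2 * D\<close>), images of relators of \<open>H\<close> of length at most
  \<open>m\<close> (\<open>D * m\<close>), and squares of the ladder
  (\<open>2 * K + D * C + 1\<close>). The assumption \<open>filled\<close> is the gap of
  \<open>H\<close>.\<close>

lemma relators_upto_retract:
  fixes k m :: int
  assumes A: "edge_map G H S T f e C" and B: "edge_map H G T S g d D"
    and gen: "generate G S = carrier G"
    and K: "\<And>y. y \<in> carrier G \<Longrightarrow> word_dist G S (g (f y)) y \<le> real K"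
    and k: "int (2 * D) \<le> k" "int D * m \<le> k" "int (2 * K + D * C + 1) \<le> k"
    and filled: "relators_upto H T (int C * a) \<subseteq> relators_upto H T m"
    and w: "w \<in> lists (S \<times> UNIV)" "word_eval G w = \<one>\<^bsub>G\<^esub>" "int (length w) \<le> a"
  shows "reduce w \<in> relators_upto G S k"
proof -
  interpret A: edge_map G H S T f e C by (rule A)
  interpret B: edge_map H G T S g d D by (rule B)
  interpret Q: group "word_class_group G S k" by (rule group_word_class_group)
  let ?c = "word_class G S k"
  have gf: "g (f y) \<in> carrier G" if "y \<in> carrier G" for y
    using that A.f B.f by simp
  have "\<exists>u. u \<in> lists (S \<times> UNIV) \<and> length u \<le> K \<and> word_eval G u = inv\<^bsub>G\<^esub> g (f y) \<otimes>\<^bsub>G\<^esub> y"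
    if "y \<in> carrier G" for y
  proof -
    have "inv\<^bsub>G\<^esub> g (f y) \<otimes>\<^bsub>G\<^esub> y \<in> carrier G" using gf[OF that] that by simp
    then obtain u where "u \<in> lists (S \<times> UNIV)" "length u = word_norm G S (inv\<^bsub>G\<^esub> g (f y) \<otimes>\<^bsub>G\<^esub> y)"
      "word_eval G u = inv\<^bsub>G\<^esub> g (f y) \<otimes>\<^bsub>G\<^esub> y"
      by (rule A.G.word_norm_attained[OF A.S gen])
    then show ?thesis using K[OF that] gf that by (auto simp: word_dist_def)
  qed
  \<comment> \<open>The word \<open>h y\<close> leads from \<open>g (f y)\<close> to
    \<open>y\<close>.\<close>
  then obtain h where h: "\<And>y. y \<in> carrier G \<Longrightarrow> h y \<in> lists (S \<times> UNIV)"
    "\<And>y. y \<in> carrier G \<Longrightarrow> length (h y) \<le> K"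
    "\<And>y. y \<in> carrier G \<Longrightarrow> word_eval G (h y) = inv\<^bsub>G\<^esub> g (f y) \<otimes>\<^bsub>G\<^esub> y"
    by metis
  let ?\<phi> = "path_map G e" and ?\<psi> = "path_map H d"
  \<comment> \<open>The original path and its image under the composite are joined by a ladder whose rungs are the
    words \<open>h y\<close>.\<close>
  have ladder: "?c (?\<psi> (f y) (?\<phi> y v) @ h (y \<otimes>\<^bsub>G\<^esub> word_eval G v)) = ?c (h y @ v)"
    if "v \<in> lists (S \<times> UNIV)" "y \<in> carrier G" for v y
    using that
  proof (induction v arbitrary: y rule: list.induct)
    case (Cons x v)
    define z where "z = y \<otimes>\<^bsub>G\<^esub> word_eval G [x]"
    have x: "x \<in> S \<times> UNIV" and xl: "[x] \<in> lists (S \<times> UNIV)" and v: "v \<in> lists (S \<times> UNIV)"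
      and y: "y \<in> carrier G"
      using Cons.prems by simp_all
    have s: "word_eval G [x] \<in> carrier G" by (rule A.letter_closed[OF x])
    have z: "z \<in> carrier G" using y s by (simp add: z_def)
    have el: "e y z \<in> lists (T \<times> UNIV)" by (rule A.edge_lists[OF y z])
    have zv: "z \<otimes>\<^bsub>G\<^esub> word_eval G v \<in> carrier G"
      using z A.G.word_eval_closed[OF A.S v] by simp
    define t where "t = h (z \<otimes>\<^bsub>G\<^esub> word_eval G v)"
    have t: "t \<in> lists (S \<times> UNIV)" using h(1)[OF zv] by (simp add: t_def)
    define p where "p = ?\<psi> (f y) (e y z)"
    have p: "p \<in> lists (S \<times> UNIV)" unfolding p_def by (rule B.path_map_lists[OF el A.f[OF y]])
    have fz: "f y \<otimes>\<^bsub>H\<^esub> word_eval H (e y z) = f z"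
      using A.edge_eval[OF y z] A.f[OF y] A.f[OF z] by (simp add: A.H.m_assoc[symmetric])
    define r where "r = ?\<psi> (f z) (?\<phi> z v)"
    have r: "r \<in> lists (S \<times> UNIV)"
      unfolding r_def by (rule B.path_map_lists[OF A.path_map_lists[OF v z] A.f[OF z]])
    have split: "?\<psi> (f y) (?\<phi> y (x # v)) = p @ r"
      using B.path_map_append[OF el A.path_map_lists[OF v z] A.f[OF y]] fz
      by (simp add: z_def p_def r_def)
    have IH: "?c (r @ t) = ?c (h z @ v)"
      using Cons.IH[OF v z] by (simp add: r_def t_def)
    \<comment> \<open>One square of the ladder: two rungs of length at most \<open>K\<close>, the
      edge \<open>x\<close>, and its image \<open>p\<close> under both maps, of length at most
      \<open>D * C\<close>.\<close>
    have square: "?c (p @ h z) = ?c (h y @ [x])"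
    proof (rule A.G.word_class_eqI[OF A.S])
      show "p @ h z \<in> lists (S \<times> UNIV)" "h y @ [x] \<in> lists (S \<times> UNIV)"
        using p h(1)[OF y] h(1)[OF z] x by auto
      have "word_eval G p = inv\<^bsub>G\<^esub> g (f y) \<otimes>\<^bsub>G\<^esub> g (f z)"
        unfolding p_def using B.path_map_eval[OF el A.f[OF y]] fz by simp
      then have "word_eval G (p @ h z)
          = (inv\<^bsub>G\<^esub> g (f y) \<otimes>\<^bsub>G\<^esub> g (f z)) \<otimes>\<^bsub>G\<^esub> (inv\<^bsub>G\<^esub> g (f z) \<otimes>\<^bsub>G\<^esub> z)"
        using A.G.word_eval_append[OF A.S h(1)[OF z] p] h(3)[OF z] by simp
      also have "\<dots> = inv\<^bsub>G\<^esub> g (f y) \<otimes>\<^bsub>G\<^esub> z"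
        by (rule A.G.inv_mult_telescope[OF gf[OF y] gf[OF z] z])
      also have "\<dots> = word_eval G (h y @ [x])"
        using A.G.word_eval_append[OF A.S xl h(1)[OF y]] h(3)[OF y] gf[OF y] y s
        by (simp add: z_def A.G.m_assoc)
      finally show "word_eval G (p @ h z) = word_eval G (h y @ [x])" .
      have "length (e y z) \<le> C" using A.edge_length[OF y x] by (simp add: z_def)
      then have "length p \<le> D * C"
        unfolding p_def
        by (intro order_trans[OF B.path_map_length[OF el A.f[OF y]]] mult_left_mono) auto
      then have "length (p @ h z) + length (h y @ [x]) \<le> 2 * K + D * C + 1"
        using h(2)[OF y] h(2)[OF z] by simp
      then show "int (length (p @ h z) + length (h y @ [x])) \<le> k"
        using k(3) by linarith
    qed
    \<comment> \<open>The induction hypothesis moves the rung to \<open>z\<close>; the square then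
      moves it past the first edge.\<close>
    have "?c (p @ r @ t) = ?c (p @ h z @ v)"
      using word_class_append[of p S "r @ t" G k] word_class_append[of p S "h z @ v" G k]
        IH p r t v h(1)[OF z]
      by (simp del: in_lists_conv_set)
    also have "\<dots> = ?c (h y @ [x] @ v)"
      using word_class_append[of "p @ h z" S v G k] word_class_append[of "h y @ [x]" S v G k]
        square p v x h(1)[OF z] h(1)[OF y]
      by (simp del: in_lists_conv_set)
    finally show ?case
      using split A.eval_Cons[OF x v y] by (simp add: z_def t_def)
  qed simp
  define v where "v = ?\<phi> \<one>\<^bsub>G\<^esub> w"
  have v: "v \<in> lists (T \<times> UNIV)"
    unfolding v_def by (rule A.path_map_lists[OF w(1)]) simp
  have f1: "f \<one>\<^bsub>G\<^esub> \<in> carrier H" by (rule A.f) simp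
  have "word_eval H v = \<one>\<^bsub>H\<^esub>"
    unfolding v_def using A.path_map_eval[OF w(1), of "\<one>\<^bsub>G\<^esub>"] w(2) f1 by simp
  moreover have "int (length v) \<le> int C * a"
  proof -
    have "int (length v) \<le> int C * int (length w)"
      unfolding v_def using A.path_map_length[OF w(1), of "\<one>\<^bsub>G\<^esub>"]
      by (metis A.G.one_closed of_nat_le_iff of_nat_mult)
    also have "\<dots> \<le> int C * a" using w(3) by (intro mult_left_mono) auto
    finally show ?thesis .
  qed
  ultimately have "reduce v \<in> relators_upto H T (int C * a)"
    by (rule A.H.reduce_in_relators_upto[OF A.T v])
  \<comment> \<open>The gap writes the image loop in terms of relators of length at most
    \<open>m\<close>, which the return map sends to trivial classes.\<close>
  then have "reduce v \<in> B.killed_loops k"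
    using filled B.relators_upto_killed[OF k(1,2)] by blast
  then have "?c (?\<psi> (f \<one>\<^bsub>G\<^esub>) (reduce v)) = \<one>\<^bsub>word_class_group G S k\<^esub>"
    using f1 unfolding B.killed_loops_def by blast
  then have one: "?c (?\<psi> (f \<one>\<^bsub>G\<^esub>) v) = \<one>\<^bsub>word_class_group G S k\<^esub>"
    using B.path_map_class_reduce[OF k(1) v f1] by simp
  have h1: "h \<one>\<^bsub>G\<^esub> \<in> lists (S \<times> UNIV)" by (rule h(1)) simp
  \<comment> \<open>Since \<open>w\<close> is a loop, both ends of its ladder carry the same rung,
    which cancels.\<close>
  have "?c (h \<one>\<^bsub>G\<^esub>) \<otimes>\<^bsub>word_class_group G S k\<^esub> ?c w = ?c (h \<one>\<^bsub>G\<^esub> @ w)"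
    by (rule word_class_append[OF h1 w(1), symmetric])
  also have "\<dots> = ?c (?\<psi> (f \<one>\<^bsub>G\<^esub>) v @ h \<one>\<^bsub>G\<^esub>)"
    using ladder[OF w(1), of "\<one>\<^bsub>G\<^esub>"] w(2) by (simp add: v_def)
  also have "\<dots> = ?c (h \<one>\<^bsub>G\<^esub>)"
    using word_class_append[OF B.path_map_lists[OF v f1] h1, of G k] one
      word_class_closed[OF h1, of G k]
    by simp
  finally have "?c w = \<one>\<^bsub>word_class_group G S k\<^esub>"
    using Q.l_cancel_one[OF word_class_closed[OF h1] word_class_closed[OF w(1)]] by simp
  then show ?thesis using word_class_eq_one_iff[OF w(1)] by blast
qed

section \<open>Choice of constants and conclusion\<close>

theorem theorem1p5:
  fixes G :: "('a, 'm) monoid_scheme" and G' :: "('b, 'n) monoid_scheme"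
    and S :: "'a set" and S' :: "'b set"
  assumes "group G" and "group G'"
    and "S \<subseteq> carrier G" and "generate G S = carrier G"
    and "S' \<subseteq> carrier G'" and "generate G' S' = carrier G'"
    and "large_scale_Lipschitz_retract
           (carrier G) (word_dist G S) (carrier G') (word_dist G' S')"
  shows "real_of_int ` relation_range G S \<preceq>\<^sub>R real_of_int ` relation_range G' S'"
proof -
  from assms(7) obtain f g K0
    where f: "large_scale_Lipschitz (carrier G) (word_dist G S) (carrier G') (word_dist G' S') f"
      and g: "large_scale_Lipschitz (carrier G') (word_dist G' S') (carrier G) (word_dist G S) g"
      and K0: "\<And>y. y \<in> carrier G \<Longrightarrow> word_dist G S (g (f y)) y \<le> K0"
    unfolding large_scale_Lipschitz_retract_def by blast
  obtain e C where A: "edge_map G G' S S' f e C"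
    using edge_map_of_Lipschitz[OF assms(1,2,3,5,6) f] .
  obtain d D where B: "edge_map G' G S' S g d D"
    using edge_map_of_Lipschitz[OF assms(2,1,5,3,4) g] .
  define K where "K = nat \<lceil>K0\<rceil>"
  have K: "word_dist G S (g (f y)) y \<le> real K" if "y \<in> carrier G" for y
    using K0[OF that] unfolding K_def by linarith
  \<comment> \<open>The summands make \<open>a \<ge> c\<close> imply the bounds on backtracks and
    squares with \<open>k = a - 1\<close>; the 2 absorbs the 1 of the square and the 1 in
    \<open>a - 1\<close>. Also \<open>D \<le> c\<close> and \<open>C \<le> c\<close>.\<close>
  define c where "c = 2 + 2 * D + 2 * K + D * C + C"
  have "\<exists>b\<in>relation_range G' S'.
      real_of_int b \<in> {inverse (real c) * real_of_int a..real c * real_of_int a}"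
    if a: "a \<in> relation_range G S" and ac: "real c \<le> real_of_int a" for a
  proof (rule ccontr)
    assume none: "\<not> ?thesis"
    have c: "c \<ge> 2" by (simp add: c_def)
    have ac': "int c \<le> a" using ac by linarith
    then have a0: "0 \<le> a" by linarith
    \<comment> \<open>The largest integer strictly below \<open>a / c\<close>. Strictness gives
      \<open>D * m \<le> a - 1\<close>, while every index above \<open>m\<close> is at least
      \<open>a / c\<close>.\<close>
    define m where "m = \<lceil>real_of_int a / real c\<rceil> - 1"
    have m_less: "real_of_int m < real_of_int a / real c" unfolding m_def by linarith
    have m_ge: "i > m \<Longrightarrow> real_of_int a / real c \<le> real_of_int i" for i :: int
      unfolding m_def by linarith
    have "0 < real_of_int a / real c" using ac c by simp
    then have m0: "0 \<le> m" unfolding m_def by linarith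
    have "real_of_int (m * int c) < real_of_int a"
      using m_less c by (simp add: field_simps)
    then have mc: "m * int c < a" by linarith
    have "int D * m \<le> a - 1"
    proof -
      have "m * int D \<le> m * int c" using m0 by (intro mult_left_mono) (auto simp: c_def)
      then show ?thesis using mc by (simp add: mult.commute)
    qed
    \<comment> \<open>All indices from \<open>m + 1\<close> to \<open>c * a\<close> lie in the
      interval that the negated claim makes free of the relation range.\<close>
    moreover have "relators_upto G' S' (int c * a) = relators_upto G' S' m"
    proof (rule relators_upto_gap[OF _ m0])
      have "m * 1 \<le> m * int c" using m0 c by (intro mult_left_mono) auto
      moreover have "1 * a \<le> int c * a" using c ac' by (intro mult_right_mono) auto
      ultimately show "m \<le> int c * a" using mc by linarith
      fix i assume i: "m < i" "i \<le> int c * a"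
      have "real_of_int i \<le> real_of_int (int c * a)" using i(2) by linarith
      then have "real_of_int i \<in> {inverse (real c) * real_of_int a..real c * real_of_int a}"
        using m_ge[OF i(1)] by (simp add: field_simps)
      then show "i \<notin> relation_range G' S'" using none by blast
    qed
    moreover have "relators_upto G' S' (int C * a) \<subseteq> relators_upto G' S' (int c * a)"
      using a0 by (intro relators_upto_mono mult_right_mono) (simp_all add: c_def)
    moreover have "int (2 * D) \<le> a - 1" "int (2 * K + D * C + 1) \<le> a - 1"
      using ac' unfolding c_def by linarith+
    ultimately have short: "reduce w \<in> relators_upto G S (a - 1)"
      if "w \<in> lists (S \<times> UNIV)" "word_eval G w = \<one>\<^bsub>G\<^esub>" "int (length w) \<le> a" for w
      using relators_upto_retract[OF A B assms(4) K, of "a - 1" m a w] that by auto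
    \<comment> \<open>Relators are reduced words, so \<open>reduce\<close> leaves them unchanged.
      Thus every generator of level \<open>a\<close> already lies in level
      \<open>a - 1\<close>.\<close>
    have "{w \<in> relators G S. int (length w) \<le> a} \<subseteq> relators_upto G S (a - 1)"
      using short by (force simp: relators_def kernel_def carrier_free_group reduce_reduced)
    then have "relators_upto G S a \<subseteq> relators_upto G S (a - 1)"
      unfolding relators_upto_def[of G S a] by (rule normal_closure_least[OF relators_upto_normal])
    then show False using a by (auto simp: relation_range_def)
  qed
  moreover have "1 \<le> real c" by (simp add: c_def)
  ultimately show ?thesis unfolding range_dominated_def by blast
qed

end
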